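(* Let $X_1,X_2$ be independent random variables uniformly distributed on $I=[0,1]$, let $\vec Y=(Y_1,Y_2)$ be a rearrangement of $\vec X=(X_1,X_2)$, and let $\mathfrak R_2=1+\#\{i<2: Y_i>Y_2\}$ be the second initial rank of $\vec Y$ (so $\mathfrak R_2=2$ if $Y_1>Y_2$, and $\mathfrak R_2=1$ otherwise). Let $\theta\in[0,1]$ and suppose that $$\mathcal P\{\mathfrak R_2=2\mid Y_1\in A\}=\theta\quad\text{for all measurable }A\subset I\text{ with }\mathrm{Leb}_1(A)>0 .$$ Then $\vec Y$ is equal in distribution to the travellers' process $\vec Y_\theta$ (for $n=2$) with parameter $\theta$.
   Context: A sequence of random variables $\vec Y=(Y_1,\dots,Y_n)$ is a rearrangement of $\vec X=(X_1,\dots,X_n)$ if there is a random permutation $\sigma$ of $\{1,\dots,n\}$, defined on the same probability space as $\vec X$ (and not assumed independent of $\vec X$), such that $\vec Y$ has the same distribution as $\vec X^\sigma:=(X_{\sigma_1},\dots,X_{\sigma_n})$. The conditional probability hypothesis is understood as $\mathcal P\{\mathfrak R_2=2,\ Y_1\in A\}=\theta\,\mathcal P\{Y_1\in A\}$. $\mathrm{Leb}_1$ is Lebesgue measure on $I$. Travellers' process: for $\theta\in[0,1]$ let $f_\theta:I\to I$ be $f_\theta(x)=\frac{\theta-x}{\theta}$ for $0\le x\le\theta$ and $f_\theta(x)=\frac{x-\theta}{1-\theta}$ for $\theta\le x\le 1$ (for $\theta=0$ only the second formula is used, so $f_0(x)=x$; for $\theta=1$ only the first, so $f_1(x)=1-x$).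 For $\vec X$ i.i.d. uniform on $[0,1]$, with probability one there is a unique permutation $\sigma=\sigma(\theta,\vec X)$ with $f_\theta(X_{\sigma_1})<\dots<f_\theta(X_{\sigma_n})$, and $\vec Y_\theta:=\vec X^{\sigma}$ for this $\sigma$. *)

theory Defs
  imports "HOL-Probability.Probability" "HOL-Combinatorics.Permutations"
begin

text \<open>
  A sequence of random variables $(X_1,\dots,X_n)$ is a function \<open>X :: nat \<Rightarrow> 'a \<Rightarrow> real\<close>
  of which only the components with index in \<open>{1..n}\<close> are relevant.
\<close>

definition joint_law :: "nat \<Rightarrow> 'a measure \<Rightarrow> (nat \<Rightarrow> 'a \<Rightarrow> real) \<Rightarrow> (nat \<Rightarrow> real) measure" where
  "joint_law n M X = distr M (Pi\<^sub>M {1..n} (\<lambda>_. borel)) (\<lambda>\<omega>. \<lambda>i\<in>{1..n}. X i \<omega>)"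

definition permuted :: "(nat \<Rightarrow> 'a \<Rightarrow> real) \<Rightarrow> ('a \<Rightarrow> nat \<Rightarrow> nat) \<Rightarrow> nat \<Rightarrow> 'a \<Rightarrow> real" where
  "permuted X \<sigma> i \<omega> = X (\<sigma> \<omega> i) \<omega>"

text \<open>
  The sequence \<open>Y\<close> may live on a probability space different from that of \<open>X\<close>; the random
  permutation lives on the space of \<open>X\<close> and may depend on \<open>X\<close> in any way.
\<close>

definition rearrangement ::
  "nat \<Rightarrow> 'a measure \<Rightarrow> (nat \<Rightarrow> 'a \<Rightarrow> real) \<Rightarrow> 'b measure \<Rightarrow> (nat \<Rightarrow> 'b \<Rightarrow> real) \<Rightarrow> bool" where
  "rearrangement n M X N Y \<longleftrightarrow>
     (\<forall>i\<in>{1..n}. Y i \<in> borel_measurable N) \<and>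
     (\<exists>\<sigma> \<in> measurable M (count_space {p. p permutes {1..n}}).
        joint_law n N Y = joint_law n M (permuted X \<sigma>))"

definition initial_rank :: "(nat \<Rightarrow> 'a \<Rightarrow> real) \<Rightarrow> nat \<Rightarrow> 'a \<Rightarrow> nat" where
  "initial_rank Y k \<omega> = 1 + card {i \<in> {1..<k}. Y i \<omega> > Y k \<omega>}"

text \<open>Only the values on \<open>{0..1}\<close> matter. For \<open>\<theta> = 0\<close> the second formula is used throughout.\<close>

definition travel_map :: "real \<Rightarrow> real \<Rightarrow> real" where
  "travel_map \<theta> x = (if 0 < \<theta> \<and> x \<le> \<theta> then (\<theta> - x) / \<theta> else (x - \<theta>) / (1 - \<theta>))"

definition sorts_travel :: "nat \<Rightarrow> real \<Rightarrow> (nat \<Rightarrow> real) \<Rightarrow> (nat \<Rightarrow> nat) \<Rightarrow> bool" where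
  "sorts_travel n \<theta> x p \<longleftrightarrow> p permutes {1..n} \<and>
     (\<forall>i\<in>{1..n}. \<forall>j\<in>{1..n}. i < j \<longrightarrow> travel_map \<theta> (x (p i)) < travel_map \<theta> (x (p j)))"

text \<open>
  If two of the values \<open>travel_map \<theta> (x i)\<close> coincide, no sorting permutation exists. For i.i.d.\
  uniform variables this has probability zero, and there the identity is chosen arbitrarily.
\<close>

definition travel_perm :: "nat \<Rightarrow> real \<Rightarrow> (nat \<Rightarrow> real) \<Rightarrow> nat \<Rightarrow> nat" where
  "travel_perm n \<theta> x =
     (if \<exists>!p. sorts_travel n \<theta> x p then THE p. sorts_travel n \<theta> x p else id)"

definition travellers_process ::
  "nat \<Rightarrow> real \<Rightarrow> (nat \<Rightarrow> 'a \<Rightarrow> real) \<Rightarrow> nat \<Rightarrow> 'a \<Rightarrow> real" where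
  "travellers_process n \<theta> X = permuted X (\<lambda>\<omega>. travel_perm n \<theta> (\<lambda>i. X i \<omega>))"

end

theory Submission
  imports Defs
begin

text \<open>
  Let $\varphi$ be $f_\theta/\theta$ on $[0,\theta]$ and $-f_\theta/(1-\theta)$ on the rest of $I$, and put
  $k(x,y) = \varphi(x)\,(1_{y<x}-\theta)$. The rank hypothesis says exactly that
  $E\,\psi(Y_1)(1_{Y_2<Y_1}-\theta)=0$ for all bounded $\psi$, so $E\,k(Y_1,Y_2)=0$. For $a<b$ the difference
  $k(b,a)-k(a,b)=\theta\varphi(a)+(1-\theta)\varphi(b)$ has the sign of $f_\theta(a)-f_\theta(b)$, so
  among all ways of ordering the pair $X_1,X_2$ the travellers' order is the only one maximising $k$.
  The maximal expectation is $0$ too, since for fixed $x$ the set $\{y: f_\theta(x)<f_\theta(y)\}$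
  has a fraction $\theta$ of its mass below $x$. Hence $\vec Y$ must be in travellers' order almost surely.
\<close>

section \<open>Weight and kernel: the pointwise comparison of the two orders of a pair\<close>

definition travel_weight :: "real \<Rightarrow> real \<Rightarrow> real" where
  "travel_weight \<theta> x = (if x \<notin> {0..1} then 0
     else if 0 < \<theta> \<and> x \<le> \<theta> then travel_map \<theta> x / \<theta> else - travel_map \<theta> x / (1 - \<theta>))"

definition rank_kernel :: "real \<Rightarrow> real \<Rightarrow> real \<Rightarrow> real" where
  "rank_kernel \<theta> x y = travel_weight \<theta> x * (of_bool (y < x) - \<theta>)"

lemma borel_measurable_travel_map [measurable]: "travel_map \<theta> \<in> borel_measurable borel"
  unfolding travel_map_def by measurable

lemma borel_measurable_travel_weight [measurable]: "travel_weight \<theta> \<in> borel_measurable borel"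
  unfolding travel_weight_def by measurable

lemma travel_map_bounds:
  assumes "\<theta> \<in> {0..1}" "x \<in> {0..1}"
  shows "travel_map \<theta> x \<in> {0..1}"
  using assms by (auto simp: travel_map_def divide_simps)

text \<open>Each branch is controlled by one summand. At \<open>\<theta> = 0\<close> or
  \<open>\<theta> = 1\<close> the summand with zero denominator is 0 by convention, and the branch
  belonging to it contains no point of I. Since the weight is set to 0 outside I, the bound is
  global, which makes every integrability claim below immediate.\<close>

lemma abs_travel_weight_le:
  assumes "\<theta> \<in> {0..1}"
  shows "\<bar>travel_weight \<theta> x\<bar> \<le> 1 / \<theta> + 1 / (1 - \<theta>)"
proof -
  have *: "\<bar>t / s\<bar> \<le> 1 / s" if "t \<in> {0..1}" "0 \<le> s" for t s :: real
    using that by (auto intro: divide_right_mono)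
  have "0 \<le> 1 / \<theta>" "0 \<le> 1 / (1 - \<theta>)"
    using assms by auto
  then show ?thesis
    using *[OF travel_map_bounds[OF assms, of x], of \<theta>]
      *[OF travel_map_bounds[OF assms, of x], of "1 - \<theta>"] assms
    by (auto simp: travel_weight_def simp del: abs_divide)
qed

lemma abs_rank_kernel_le:
  assumes "\<theta> \<in> {0..1}"
  shows "\<bar>rank_kernel \<theta> x y\<bar> \<le> 1 / \<theta> + 1 / (1 - \<theta>)"
proof -
  have "\<bar>rank_kernel \<theta> x y\<bar> \<le> \<bar>travel_weight \<theta> x\<bar> * 1"
    unfolding rank_kernel_def abs_mult using assms by (intro mult_left_mono) auto
  then show ?thesis using abs_travel_weight_le[OF assms, of x] by simp
qed

text \<open>On the decreasing branch \<open>\<theta>\<close> times the weight is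
  \<open>travel_map\<close>, on the increasing one \<open>1 - \<theta>\<close> times the weight is
  minus \<open>travel_map\<close>. For \<open>a < b\<close> on different branches the gain
  \<open>\<theta> * travel_weight \<theta> a + (1 - \<theta>) * travel_weight \<theta> b\<close> is
  therefore exactly the difference of the two images. For \<open>a\<close>, \<open>b\<close> on one
  branch, monotonicity fixes the order of the images, and both weights have the matching sign.
  \<open>D\<close> and \<open>D'\<close> treat the two possible signs.\<close>

lemma rank_kernel_less_swap:
  assumes "\<theta> \<in> {0..1}" "x \<in> {0..1}" "y \<in> {0..1}" "travel_map \<theta> y < travel_map \<theta> x"
  shows "rank_kernel \<theta> x y < rank_kernel \<theta> y x"
proof -
  have low: "travel_map \<theta> u = (\<theta> - u) / \<theta>" "\<theta> * travel_weight \<theta> u = travel_map \<theta> u"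
    if "u \<in> {0..1}" "u \<le> \<theta>" "0 < \<theta>" for u
    using that by (auto simp: travel_weight_def travel_map_def)
  have high: "travel_map \<theta> u = (u - \<theta>) / (1 - \<theta>)" "(1 - \<theta>) * travel_weight \<theta> u = - travel_map \<theta> u"
    if "u \<in> {0..1}" "\<not> (u \<le> \<theta> \<and> 0 < \<theta>)" for u
    using that assms by (auto simp: travel_weight_def travel_map_def)
  have pos: "0 \<le> travel_weight \<theta> u" if "u \<in> {0..1}" "u \<le> \<theta>" "0 < \<theta>" for u
    using that by (auto simp: travel_weight_def travel_map_def)
  have neg: "travel_weight \<theta> u \<le> 0" if "u \<in> {0..1}" "\<not> (u \<le> \<theta> \<and> 0 < \<theta>)" for u
    using that assms by (auto simp: travel_weight_def travel_map_def divide_simps)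
  have D: "0 < \<theta> * travel_weight \<theta> a + (1 - \<theta>) * travel_weight \<theta> b"
    if ab: "a \<in> {0..1}" "b \<in> {0..1}" "a < b" "travel_map \<theta> b < travel_map \<theta> a" for a b
  proof (cases "0 < \<theta> \<and> a \<le> \<theta>")
    case a: True
    show ?thesis
    proof (cases "b \<le> \<theta>")
      case True
      then have "0 < travel_map \<theta> a" "0 \<le> (1 - \<theta>) * travel_weight \<theta> b"
        using a ab low(1)[of a] pos[of b] assms(1) by auto
      then show ?thesis using low(2)[of a] a ab by auto
    next
      case False
      then show ?thesis using low(2)[of a] high(2)[of b] a ab by auto
    qed
  next
    case False
    then have "travel_map \<theta> a \<le> travel_map \<theta> b"
      using ab high(1)[of a] high(1)[of b] assms(1) divide_right_mono[of "a - \<theta>" "b - \<theta>" "1 - \<theta>"]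
      by auto
    then show ?thesis using ab by simp
  qed
  have D': "\<theta> * travel_weight \<theta> a + (1 - \<theta>) * travel_weight \<theta> b < 0"
    if ab: "a \<in> {0..1}" "b \<in> {0..1}" "a < b" "travel_map \<theta> a < travel_map \<theta> b" for a b
  proof (cases "b \<le> \<theta> \<and> 0 < \<theta>")
    case True
    then have "travel_map \<theta> b \<le> travel_map \<theta> a"
      using ab low(1)[of a] low(1)[of b] divide_right_mono[of "\<theta> - b" "\<theta> - a" \<theta>] by auto
    then show ?thesis using ab by simp
  next
    \<comment> \<open>Strictness comes from \<open>b\<close> alone: its image exceeds that of
      \<open>a\<close>, which is nonnegative.\<close>
    case b: False
    have pb: "0 < travel_map \<theta> b"
      using travel_map_bounds[OF assms(1) ab(1)] ab by auto
    show ?thesis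
    proof (cases "a \<le> \<theta> \<and> 0 < \<theta>")
      case True
      then show ?thesis using low(2)[of a] high(2)[of b] b ab by auto
    next
      case False
      then have "\<theta> * travel_weight \<theta> a \<le> 0"
        using neg[of a] ab assms(1) by (auto simp: mult_nonneg_nonpos)
      then show ?thesis using high(2)[of b] b ab pb by auto
    qed
  qed
  consider "x < y" | "y < x" | "x = y" by linarith
  then show ?thesis
  proof cases
    case 1
    then show ?thesis using D[of x y] assms by (auto simp: rank_kernel_def algebra_simps)
  next
    case 2
    then show ?thesis using D'[of y x] assms by (auto simp: rank_kernel_def algebra_simps)
  qed (use assms in auto)
qed

section \<open>Uniform points: level sets of the travel map and the mean of the kernel in
  travellers' order\<close>

abbreviation (input) unif01 :: "real measure" where "unif01 \<equiv> uniform_measure lborel {0..1}"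

lemma prob_space_unif01: "prob_space unif01"
  by (rule prob_space_uniform_measure) auto

lemma measure_unif01: "A \<in> sets borel \<Longrightarrow> measure unif01 A = measure lborel ({0..1} \<inter> A)"
  by (subst measure_uniform_measure) auto

text \<open>With \<open>s = travel_map \<theta> x\<close>, the points of I with image above
  \<open>s\<close> form a left interval of length \<open>\<theta> * (1 - s)\<close> and a right
  interval of length \<open>(1 - \<theta>) * (1 - s)\<close>. The point \<open>x\<close> bounds one
  of them and lies between the two, so the part below \<open>x\<close> is the left interval, a
  fraction \<open>\<theta>\<close> of the total.\<close>

lemma travellers_balance:
  assumes "\<theta> \<in> {0..1}" "x \<in> {0..1}"
  shows "measure unif01 {y. y < x \<and> travel_map \<theta> x < travel_map \<theta> y}
           = \<theta> * measure unif01 {y. travel_map \<theta> x < travel_map \<theta> y}"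
proof (cases "0 < \<theta> \<and> x \<le> \<theta>")
  case True
  \<comment> \<open>For \<open>\<theta> < 1\<close> this is the point of the increasing branch with
    the same image as \<open>x\<close>. At \<open>\<theta> = 1\<close> it is 1, and the right
    interval is empty.\<close>
  define x' where "x' = \<theta> + (1 - \<theta>) * ((\<theta> - x) / \<theta>)"
  have fx: "travel_map \<theta> x = (\<theta> - x) / \<theta>" "0 \<le> (\<theta> - x) / \<theta>" "(\<theta> - x) / \<theta> \<le> 1"
    using True assms by (auto simp: travel_map_def divide_simps)
  have x': "\<theta> \<le> x'" "x' \<le> 1"
    unfolding x'_def
    using fx assms mult_left_mono[OF fx(3), of "1 - \<theta>"] mult_nonneg_nonneg[OF _ fx(2), of "1 - \<theta>"]
    by (auto simp del: times_divide_eq_right)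
  have f: "travel_map \<theta> x < travel_map \<theta> y \<longleftrightarrow> y < x \<or> x' < y" if "y \<in> {0..1}" for y
  proof (cases "y \<le> \<theta>")
    case y: True
    then show ?thesis using True x' by (auto simp: travel_map_def divide_simps)
  next
    case False
    then show ?thesis using True that fx
      by (auto simp: travel_map_def x'_def pos_less_divide_eq algebra_simps)
  qed
  have 1: "{0..1} \<inter> {y. y < x \<and> travel_map \<theta> x < travel_map \<theta> y} = {0..<x}"
    using assms f by auto
  have 2: "{0..1} \<inter> {y. travel_map \<theta> x < travel_map \<theta> y} = {0..<x} \<union> {x'<..1}"
    using assms True x' f by auto
  have "measure lborel ({0..<x} \<union> {x'<..1}) = x + (1 - x')"
    using assms x' True by (subst measure_Union) (auto simp: measure_def)
  then show ?thesis
    using True assms by (simp add: measure_unif01 1 2 x'_def field_simps)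
next
  case False
  define s where "s = travel_map \<theta> x"
  have s: "0 \<le> s" "s \<le> 1" using travel_map_bounds[OF assms] by (auto simp: s_def)
  \<comment> \<open>The mirror case: for \<open>0 < \<theta>\<close> this is the point of the
    decreasing branch with image \<open>s\<close>. At \<open>\<theta> = 0\<close> it is 0, and the
    left interval is empty.\<close>
  define x' where "x' = \<theta> * (1 - s)"
  have \<theta>: "\<theta> < 1" using False assms by auto
  have fx: "s = (x - \<theta>) / (1 - \<theta>)"
    using False by (auto simp: travel_map_def s_def)
  then have xs: "x = \<theta> + (1 - \<theta>) * s" using \<theta> by auto
  have x': "0 \<le> x'" "x' \<le> \<theta>" "\<theta> \<le> x"
    unfolding x'_def using s assms False by (auto simp: mult_left_le)
  have f: "s < travel_map \<theta> y \<longleftrightarrow> y < x' \<or> x < y" if "y \<in> {0..1}" for y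
  proof (cases "0 < \<theta> \<and> y \<le> \<theta>")
    case y: True
    then show ?thesis using x'
      by (auto simp: travel_map_def x'_def pos_less_divide_eq algebra_simps)
  next
    case False
    then have "travel_map \<theta> y = (y - \<theta>) / (1 - \<theta>)" by (auto simp: travel_map_def)
    then show ?thesis using False x' \<theta> that assms by (auto simp: fx divide_strict_right_mono divide_less_cancel)
  qed
  have 1: "{0..1} \<inter> {y. y < x \<and> s < travel_map \<theta> y} = {0..<x'}"
    using assms x' f by auto
  have 2: "{0..1} \<inter> {y. s < travel_map \<theta> y} = {0..<x'} \<union> {x<..1}"
    using assms x' f by auto
  have "measure lborel ({0..<x'} \<union> {x<..1}) = x' + (1 - x)"
    using assms x' by (subst measure_Union) (auto simp: measure_def)
  then show ?thesis
    unfolding s_def[symmetric] using x'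
    by (simp add: measure_unif01 1 2) (simp add: x'_def xs algebra_simps)
qed

text \<open>On I each affine branch takes a given value at most once, so all ties with
  \<open>x\<close> lie in the finite set \<open>?S\<close>.\<close>

lemma AE_unif01_travel_map_neq:
  assumes "\<theta> \<in> {0..1}"
  shows "AE y in unif01. travel_map \<theta> x \<noteq> travel_map \<theta> y"
proof -
  let ?S = "{\<theta> - \<theta> * travel_map \<theta> x, \<theta> + (1 - \<theta>) * travel_map \<theta> x, 1}"
  have "y \<in> ?S" if "y \<in> {0..1}" "travel_map \<theta> x = travel_map \<theta> y" for y
    using that assms by (auto simp: travel_map_def)
  moreover have "AE y in lborel. y \<notin> ?S"
    by (intro AE_not_in finite_imp_null_set_lborel) auto
  ultimately have "AE y in lborel. y \<in> {0..1} \<longrightarrow> travel_map \<theta> x \<noteq> travel_map \<theta> y"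
    by fastforce
  then show ?thesis
    by (intro AE_uniform_measureI) auto
qed

text \<open>By Fubini, integrate over \<open>y\<close> first. The weight depends on \<open>x\<close>
  only and factors out, leaving the difference that \<open>travellers_balance\<close> annihilates.
  For \<open>x\<close> outside I the weight itself is 0.\<close>

lemma integral_rank_kernel_travellers:
  assumes "\<theta> \<in> {0..1}"
  shows "(\<integral>z. rank_kernel \<theta> (fst z) (snd z) * of_bool (travel_map \<theta> (fst z) < travel_map \<theta> (snd z))
           \<partial>(unif01 \<Otimes>\<^sub>M unif01)) = 0"
proof -
  interpret U: prob_space unif01 by (rule prob_space_unif01)
  interpret UU: pair_prob_space unif01 unif01 ..
  let ?g = "\<lambda>z. rank_kernel \<theta> (fst z) (snd z) * of_bool (travel_map \<theta> (fst z) < travel_map \<theta> (snd z))"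
  have [measurable]: "?g \<in> borel_measurable (unif01 \<Otimes>\<^sub>M unif01)"
    unfolding rank_kernel_def by measurable
  have "integrable (unif01 \<Otimes>\<^sub>M unif01) ?g"
  proof (rule UU.integrable_const_bound)
    show "AE z in unif01 \<Otimes>\<^sub>M unif01. norm (?g z) \<le> 1 / \<theta> + 1 / (1 - \<theta>)"
      using abs_rank_kernel_le[OF assms] assms by (auto simp: abs_mult of_bool_def)
  qed measurable
  then have "integral\<^sup>L (unif01 \<Otimes>\<^sub>M unif01) ?g = (\<integral>x. \<integral>y. ?g (x, y) \<partial>unif01 \<partial>unif01)"
    by (rule UU.integral_fst'[symmetric])
  moreover have "(\<integral>y. ?g (x, y) \<partial>unif01) = 0" for x
  proof (cases "x \<in> {0..1}")
    case True
    have [simp]: "integrable unif01 (\<lambda>y. indicator A y :: real)" if [measurable]: "A \<in> sets borel" for A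
      by (rule U.integrable_const_bound[of _ 1]) (auto simp: indicator_def)
    let ?B = "{y. y < x \<and> travel_map \<theta> x < travel_map \<theta> y}"
    let ?C = "{y. travel_map \<theta> x < travel_map \<theta> y}"
    have [measurable]: "?B \<in> sets borel" "?C \<in> sets borel" by measurable
    have "(\<integral>y. ?g (x, y) \<partial>unif01) = (\<integral>y. travel_weight \<theta> x * (indicator ?B y - \<theta> * indicator ?C y) \<partial>unif01)"
      by (intro Bochner_Integration.integral_cong refl)
        (simp add: rank_kernel_def indicator_def algebra_simps)
    also have "\<dots> = travel_weight \<theta> x * (measure unif01 ?B - \<theta> * measure unif01 ?C)"
      by simp
    finally show ?thesis using travellers_balance[OF assms True] by simp
  qed (simp add: rank_kernel_def travel_weight_def)
  ultimately show ?thesis by simp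
qed

section \<open>The sorting permutation of two points\<close>

lemma travel_perm_2:
  "travel_perm 2 \<theta> x =
     (if travel_map \<theta> (x 2) < travel_map \<theta> (x 1) then Transposition.transpose 1 2 else id)"
proof -
  have eq: "{1..2} = {1, 2 :: nat}" by auto
  have sorts: "sorts_travel 2 \<theta> x p \<longleftrightarrow> (p = id \<and> travel_map \<theta> (x 1) < travel_map \<theta> (x 2)) \<or>
      (p = Transposition.transpose 1 2 \<and> travel_map \<theta> (x 2) < travel_map \<theta> (x 1))" for p
    unfolding sorts_travel_def eq permutes_doubleton_iff by auto
  consider "travel_map \<theta> (x 1) < travel_map \<theta> (x 2)" | "travel_map \<theta> (x 2) < travel_map \<theta> (x 1)"
    | "travel_map \<theta> (x 1) = travel_map \<theta> (x 2)" by linarith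
  then show ?thesis
  proof cases
    case 1
    then have "sorts_travel 2 \<theta> x = (\<lambda>p. p = id)" by (intro ext) (auto simp: sorts)
    then show ?thesis using 1 by (simp add: travel_perm_def)
  next
    case 2
    then have "sorts_travel 2 \<theta> x = (\<lambda>p. p = Transposition.transpose 1 2)" by (intro ext) (auto simp: sorts)
    then show ?thesis using 2 by (simp add: travel_perm_def)
  next
    \<comment> \<open>On a tie no permutation sorts strictly, so the default \<open>id\<close>
      applies. It agrees with the else branch, hence the formula holds for every
      \<open>x\<close>.\<close>
    case 3
    then have "sorts_travel 2 \<theta> x = (\<lambda>p. False)" by (intro ext) (auto simp: sorts)
    then show ?thesis using 3 by (simp add: travel_perm_def Ex1_def)
  qed
qed

section \<open>The expectation argument on the space of the uniform pair\<close>

context prob_space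
begin

text \<open>The hypothesis identifies two measures on the line: the image under \<open>Z\<close> of
  \<open>M\<close> restricted to \<open>E\<close>, and \<open>\<theta>\<close> times the law of
  \<open>Z\<close>. Integrating \<open>g\<close> against both gives the claim. This passes from the
  rank condition on sets to one on weights.\<close>

lemma integral_eq_if_event_proportional:
  fixes Z :: "'a \<Rightarrow> real" and g :: "real \<Rightarrow> real"
  assumes [measurable]: "E \<in> events" "random_variable borel Z" "g \<in> borel_measurable borel"
    and "0 \<le> \<theta>"
    and proportional: "\<And>A. A \<in> sets borel \<Longrightarrow> prob (E \<inter> (Z -` A \<inter> space M)) = \<theta> * prob (Z -` A \<inter> space M)"
  shows "(\<integral>\<omega>. indicator E \<omega> * g (Z \<omega>) \<partial>M) = \<theta> * (\<integral>\<omega>. g (Z \<omega>) \<partial>M)"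
proof -
  have eq: "distr (density M (indicator E)) borel Z = density (distr M borel Z) (\<lambda>_. ennreal \<theta>)"
  proof (rule measure_eqI)
    fix A assume "A \<in> sets (distr (density M (indicator E)) borel Z)"
    then have A [measurable]: "A \<in> sets borel" by simp
    then show "emeasure (distr (density M (indicator E)) borel Z) A
        = emeasure (density (distr M borel Z) (\<lambda>_. ennreal \<theta>)) A"
      using proportional[OF A] \<open>0 \<le> \<theta>\<close>
      by (simp add: emeasure_distr emeasure_restricted emeasure_density_const emeasure_eq_measure
          flip: ennreal_mult)
  qed simp
  have "(\<integral>\<omega>. indicator E \<omega> * g (Z \<omega>) \<partial>M) = (\<integral>\<omega>. g (Z \<omega>) \<partial>(density M (\<lambda>\<omega>. ennreal (indicator E \<omega>))))"
    by (subst integral_density) auto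
  also have "\<dots> = integral\<^sup>L (distr (density M (indicator E)) borel Z) g"
    by (subst integral_distr) (auto simp: ennreal_indicator)
  also have "\<dots> = \<theta> * (\<integral>\<omega>. g (Z \<omega>) \<partial>M)"
    unfolding eq using \<open>0 \<le> \<theta>\<close> by (subst integral_density) (auto simp: integral_distr)
  finally show ?thesis .
qed

lemma rearranged_pair_sorted:
  fixes X\<^sub>1 X\<^sub>2 Z\<^sub>1 Z\<^sub>2 :: "'a \<Rightarrow> real"
  assumes \<theta>: "\<theta> \<in> {0..1}"
    and indep: "indep_var borel X\<^sub>1 borel X\<^sub>2"
    and unif: "distr M borel X\<^sub>1 = unif01" "distr M borel X\<^sub>2 = unif01"
    and Z [measurable]: "random_variable borel Z\<^sub>1" "random_variable borel Z\<^sub>2"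
    and perm: "\<And>\<omega>. \<omega> \<in> space M \<Longrightarrow>
          Z\<^sub>1 \<omega> = X\<^sub>1 \<omega> \<and> Z\<^sub>2 \<omega> = X\<^sub>2 \<omega> \<or> Z\<^sub>1 \<omega> = X\<^sub>2 \<omega> \<and> Z\<^sub>2 \<omega> = X\<^sub>1 \<omega>"
    and rank: "\<And>A. A \<in> sets borel \<Longrightarrow> A \<subseteq> {0..1} \<Longrightarrow> emeasure lborel A > 0 \<Longrightarrow>
          prob {\<omega> \<in> space M. Z\<^sub>2 \<omega> < Z\<^sub>1 \<omega> \<and> Z\<^sub>1 \<omega> \<in> A} = \<theta> * prob {\<omega> \<in> space M. Z\<^sub>1 \<omega> \<in> A}"
  shows "AE \<omega> in M. travel_map \<theta> (Z\<^sub>1 \<omega>) < travel_map \<theta> (Z\<^sub>2 \<omega>)"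
proof -
  interpret U: prob_space unif01 by (rule prob_space_unif01)
  interpret UU: pair_prob_space unif01 unif01 ..
  have X [measurable]: "random_variable borel X\<^sub>1" "random_variable borel X\<^sub>2"
    using indep by (auto dest: indep_var_rv1 indep_var_rv2)
  have law: "distr M (borel \<Otimes>\<^sub>M borel) (\<lambda>\<omega>. (X\<^sub>1 \<omega>, X\<^sub>2 \<omega>)) = unif01 \<Otimes>\<^sub>M unif01"
    using indep unfolding indep_var_distribution_eq unif by simp
  \<comment> \<open>The maximal kernel value involves both orders of the pair, so the swapped pair
    must have the product law as well.\<close>
  have law': "distr M (borel \<Otimes>\<^sub>M borel) (\<lambda>\<omega>. (X\<^sub>2 \<omega>, X\<^sub>1 \<omega>)) = unif01 \<Otimes>\<^sub>M unif01"
  proof -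
    have "distr M (borel \<Otimes>\<^sub>M borel) (\<lambda>\<omega>. (X\<^sub>2 \<omega>, X\<^sub>1 \<omega>))
        = distr (distr M (borel \<Otimes>\<^sub>M borel) (\<lambda>\<omega>. (X\<^sub>1 \<omega>, X\<^sub>2 \<omega>))) (borel \<Otimes>\<^sub>M borel) (\<lambda>(x, y). (y, x))"
      by (subst distr_distr) (auto simp: comp_def)
    also have "\<dots> = distr (unif01 \<Otimes>\<^sub>M unif01) (unif01 \<Otimes>\<^sub>M unif01) (\<lambda>(x, y). (y, x))"
      unfolding law by (intro distr_cong) (auto intro!: sets_pair_measure_cong)
    also have "\<dots> = unif01 \<Otimes>\<^sub>M unif01"
      by (rule UU.distr_pair_swap[symmetric])
    finally show ?thesis .
  qed
  have AE_X: "AE \<omega> in M. P (X\<^sub>i \<omega>)"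
    if "distr M borel X\<^sub>i = unif01" "random_variable borel X\<^sub>i" "Measurable.pred borel P"
       "AE x in lborel. x \<in> {0..1} \<longrightarrow> P x" for P X\<^sub>i
  proof -
    note [measurable] = that(2,3)
    have "AE x in unif01. P x" using that(4) by (intro AE_uniform_measureI) auto
    then have "AE x in distr M borel X\<^sub>i. P x" unfolding that(1) .
    then show ?thesis by (subst (asm) AE_distr_iff) auto
  qed
  have AE_I: "AE \<omega> in M. X\<^sub>1 \<omega> \<in> {0..1} \<and> X\<^sub>2 \<omega> \<in> {0..1}"
    using AE_X[OF unif(1) X(1), of "\<lambda>x. x \<in> {0..1}"] AE_X[OF unif(2) X(2), of "\<lambda>x. x \<in> {0..1}"]
    by auto
  have AE_neq: "AE \<omega> in M. travel_map \<theta> (X\<^sub>1 \<omega>) \<noteq> travel_map \<theta> (X\<^sub>2 \<omega>)"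
  proof -
    have "AE z in unif01 \<Otimes>\<^sub>M unif01. travel_map \<theta> (fst z) \<noteq> travel_map \<theta> (snd z)"
    proof (rule UU.AE_pair_measure)
      show "{z \<in> space (unif01 \<Otimes>\<^sub>M unif01). travel_map \<theta> (fst z) \<noteq> travel_map \<theta> (snd z)} \<in> sets (unif01 \<Otimes>\<^sub>M unif01)"
        by measurable
    qed (use AE_unif01_travel_map_neq[OF \<theta>] in simp)
    then show ?thesis
      unfolding law[symmetric] by (subst (asm) AE_distr_iff) auto
  qed
  \<comment> \<open>The rank condition is extended to all Borel sets. Cutting \<open>A\<close> down
    to I changes nothing almost surely. If the remainder is Lebesgue null, both sides vanish,
    because \<open>Z\<^sub>1\<close> is always one of the two uniform variables.\<close>
  have rank': "prob ({\<omega> \<in> space M. Z\<^sub>2 \<omega> < Z\<^sub>1 \<omega>} \<inter> (Z\<^sub>1 -` A \<inter> space M)) = \<theta> * prob (Z\<^sub>1 -` A \<inter> space M)"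
    if [measurable]: "A \<in> sets borel" for A
  proof -
    let ?A = "A \<inter> {0..1}"
    have "AE \<omega> in M. Z\<^sub>1 \<omega> \<in> {0..1}"
      using AE_I AE_space
    proof eventually_elim
      case (elim \<omega>)
      then show ?case using perm[OF elim(2)] by auto
    qed
    then have 1: "prob ({\<omega> \<in> space M. Z\<^sub>2 \<omega> < Z\<^sub>1 \<omega>} \<inter> (Z\<^sub>1 -` A \<inter> space M))
        = prob {\<omega> \<in> space M. Z\<^sub>2 \<omega> < Z\<^sub>1 \<omega> \<and> Z\<^sub>1 \<omega> \<in> ?A}"
      and 2: "prob (Z\<^sub>1 -` A \<inter> space M) = prob {\<omega> \<in> space M. Z\<^sub>1 \<omega> \<in> ?A}"
      by (intro finite_measure_eq_AE; auto)+
    show ?thesis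
    proof (cases "emeasure lborel ?A > 0")
      case True
      then show ?thesis using rank[of ?A] unfolding 1 2 by auto
    next
      case False
      then have "?A \<in> null_sets lborel" by auto
      then have "AE x in lborel. x \<in> {0..1} \<longrightarrow> x \<notin> ?A"
        using AE_not_in by fastforce
      then have "AE \<omega> in M. X\<^sub>1 \<omega> \<notin> ?A \<and> X\<^sub>2 \<omega> \<notin> ?A"
        using AE_X[OF unif(1) X(1), of "\<lambda>x. x \<notin> ?A"] AE_X[OF unif(2) X(2), of "\<lambda>x. x \<notin> ?A"]
        by auto
      then have "AE \<omega> in M. Z\<^sub>1 \<omega> \<notin> ?A"
        using AE_space
      proof eventually_elim
        case (elim \<omega>)
        then show ?case using perm[OF elim(2)] by metis
      qed
      then have "prob {\<omega> \<in> space M. Z\<^sub>1 \<omega> \<in> ?A} = 0"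
        "prob {\<omega> \<in> space M. Z\<^sub>2 \<omega> < Z\<^sub>1 \<omega> \<and> Z\<^sub>1 \<omega> \<in> ?A} = 0"
        by (auto intro!: prob_eq_0_AE)
      then show ?thesis unfolding 1 2 by simp
    qed
  qed
  define k where "k = rank_kernel \<theta>"
  define g where "g x y = k x y * of_bool (travel_map \<theta> x < travel_map \<theta> y)" for x y
  have k_meas [measurable]: "(\<lambda>\<omega>. k (A \<omega>) (B \<omega>)) \<in> borel_measurable M"
    if [measurable]: "random_variable borel A" "random_variable borel B" for A B
    unfolding k_def rank_kernel_def by measurable
  have k_int: "integrable M (\<lambda>\<omega>. k (A \<omega>) (B \<omega>))"
    if "random_variable borel A" "random_variable borel B" for A B
    by (rule integrable_const_bound[OF _ k_meas[OF that]])
      (use abs_rank_kernel_le[OF \<theta>] in \<open>auto simp: k_def\<close>)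
  have g_int: "integrable M (\<lambda>\<omega>. g (A \<omega>) (B \<omega>))"
    if [measurable]: "random_variable borel A" "random_variable borel B" for A B
    using k_int[OF that] unfolding g_def
    by (rule Bochner_Integration.integrable_bound) (auto simp: abs_mult)
  have int_g: "(\<integral>\<omega>. g (A \<omega>) (B \<omega>) \<partial>M) = 0"
    if [measurable]: "random_variable borel A" "random_variable borel B"
      and l: "distr M (borel \<Otimes>\<^sub>M borel) (\<lambda>\<omega>. (A \<omega>, B \<omega>)) = unif01 \<Otimes>\<^sub>M unif01" for A B
  proof -
    have "(\<integral>z. g (fst z) (snd z) \<partial>distr M (borel \<Otimes>\<^sub>M borel) (\<lambda>\<omega>. (A \<omega>, B \<omega>))) = 0"
      unfolding l using integral_rank_kernel_travellers[OF \<theta>] by (simp add: g_def k_def)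
    then show ?thesis
      by (subst (asm) integral_distr) (auto simp: g_def k_def rank_kernel_def)
  qed
  \<comment> \<open>Off ties exactly one of the two conditions inside \<open>g\<close> holds, and
    that term is the kernel in travellers' order. So \<open>?h\<close> is the loss of
    \<open>Z\<close> against the best order.\<close>
  let ?h = "\<lambda>\<omega>. g (X\<^sub>1 \<omega>) (X\<^sub>2 \<omega>) + g (X\<^sub>2 \<omega>) (X\<^sub>1 \<omega>) - k (Z\<^sub>1 \<omega>) (Z\<^sub>2 \<omega>)"
  have "(\<integral>\<omega>. k (Z\<^sub>1 \<omega>) (Z\<^sub>2 \<omega>) \<partial>M) = 0"
  proof -
    let ?E = "{\<omega> \<in> space M. Z\<^sub>2 \<omega> < Z\<^sub>1 \<omega>}" and ?w = "\<lambda>\<omega>. travel_weight \<theta> (Z\<^sub>1 \<omega>)"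
    have w: "integrable M ?w"
      by (rule integrable_const_bound[of _ "1 / \<theta> + 1 / (1 - \<theta>)"])
        (use abs_travel_weight_le[OF \<theta>] in auto)
    have wE: "integrable M (\<lambda>\<omega>. indicator ?E \<omega> * ?w \<omega>)"
      using w by (rule Bochner_Integration.integrable_bound) (auto simp: indicator_def)
    have "(\<integral>\<omega>. k (Z\<^sub>1 \<omega>) (Z\<^sub>2 \<omega>) \<partial>M) = (\<integral>\<omega>. indicator ?E \<omega> * ?w \<omega> - \<theta> * ?w \<omega> \<partial>M)"
      by (intro Bochner_Integration.integral_cong) (auto simp: k_def rank_kernel_def algebra_simps)
    also have "\<dots> = (\<integral>\<omega>. indicator ?E \<omega> * ?w \<omega> \<partial>M) - \<theta> * (\<integral>\<omega>. ?w \<omega> \<partial>M)"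
      using w wE by simp
    also have "\<dots> = 0"
      using integral_eq_if_event_proportional[of ?E Z\<^sub>1 "travel_weight \<theta>" \<theta>] rank' \<theta> by simp
    finally show ?thesis .
  qed
  then have int_h: "integral\<^sup>L M ?h = 0"
    using int_g[OF X law] int_g[OF X(2,1) law'] k_int[OF Z] g_int[OF X] g_int[OF X(2,1)] by simp
  have h: "AE \<omega> in M. 0 \<le> ?h \<omega> \<and>
      (?h \<omega> = 0 \<longrightarrow> travel_map \<theta> (Z\<^sub>1 \<omega>) < travel_map \<theta> (Z\<^sub>2 \<omega>))"
    using AE_I AE_neq AE_space
  proof eventually_elim
    case (elim \<omega>)
    \<comment> \<open>With \<open>x\<close> before \<open>y\<close> in travellers' order, the loss
      is 0 if \<open>z = x\<close> and \<open>z' = y\<close>. For the reversed pair it is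
      \<open>k x y - k y x\<close>, which is strictly positive by
      \<open>rank_kernel_less_swap\<close>.\<close>
    have "0 \<le> g x y + g y x - k z z' \<and> (g x y + g y x - k z z' = 0 \<longrightarrow> travel_map \<theta> z < travel_map \<theta> z')"
      if "x \<in> {0..1}" "y \<in> {0..1}" "travel_map \<theta> x < travel_map \<theta> y"
        "z = x \<and> z' = y \<or> z = y \<and> z' = x" for x y z z'
      using rank_kernel_less_swap[OF \<theta> that(2,1,3)] that by (auto simp: g_def k_def)
    from this[of "X\<^sub>1 \<omega>" "X\<^sub>2 \<omega>" "Z\<^sub>1 \<omega>" "Z\<^sub>2 \<omega>"] this[of "X\<^sub>2 \<omega>" "X\<^sub>1 \<omega>" "Z\<^sub>1 \<omega>" "Z\<^sub>2 \<omega>"]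
    show ?case
      using elim perm[OF elim(3)] by (cases "travel_map \<theta> (X\<^sub>1 \<omega>) < travel_map \<theta> (X\<^sub>2 \<omega>)") (auto simp: add.commute)
  qed
  \<comment> \<open>A nonnegative integrable function with integral 0 vanishes almost
    everywhere.\<close>
  have "AE \<omega> in M. ?h \<omega> = 0"
    using int_h h k_int[OF Z] g_int[OF X] g_int[OF X(2,1)]
    by (subst integral_nonneg_eq_0_iff_AE[symmetric]) auto
  with h show ?thesis by eventually_elim auto
qed

end

section \<open>Passing between the two probability spaces, and the conclusion\<close>

lemma measure_joint_law_2:
  fixes Y :: "nat \<Rightarrow> 'a \<Rightarrow> real"
  assumes "\<And>i. i \<in> {1..2} \<Longrightarrow> Y i \<in> borel_measurable N" and "B \<in> sets (borel \<Otimes>\<^sub>M borel)"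
  shows "measure (joint_law 2 N Y) {v \<in> space (Pi\<^sub>M {1..2} (\<lambda>_. borel)). (v 1, v 2) \<in> B}
           = measure N {\<omega> \<in> space N. (Y 1 \<omega>, Y 2 \<omega>) \<in> B}"
proof -
  have "(\<lambda>\<omega>. \<lambda>i\<in>{1..2}. Y i \<omega>) \<in> measurable N (Pi\<^sub>M {1..2} (\<lambda>_. borel))"
    using assms(1) by (intro measurable_restrict) auto
  moreover have "{v \<in> space (Pi\<^sub>M {1..2::nat} (\<lambda>_. borel :: real measure)). (v 1, v 2) \<in> B}
      \<in> sets (Pi\<^sub>M {1..2} (\<lambda>_. borel))"
    using assms(2) by measurable
  ultimately show ?thesis
    unfolding joint_law_def
    by (subst measure_distr) (auto intro!: arg_cong[where f = "measure N"] simp: space_PiM)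
qed

theorem theorem1:
  fixes M :: "'a measure" and N :: "'b measure"
    and X :: "nat \<Rightarrow> 'a \<Rightarrow> real" and Y :: "nat \<Rightarrow> 'b \<Rightarrow> real" and \<theta> :: real
  assumes "prob_space M" and "prob_space N"
    and "prob_space.indep_vars M (\<lambda>_. borel) X {1..2}"
    and "\<And>i. i \<in> {1..2} \<Longrightarrow> distr M borel (X i) = uniform_measure lborel {0..1}"
    and "rearrangement 2 M X N Y"
    and "\<theta> \<in> {0..1}"
    and "\<And>A. A \<in> sets borel \<Longrightarrow> A \<subseteq> {0..1} \<Longrightarrow> emeasure lborel A > 0 \<Longrightarrow>
           measure N {\<omega> \<in> space N. initial_rank Y 2 \<omega> = 2 \<and> Y 1 \<omega> \<in> A}
             = \<theta> * measure N {\<omega> \<in> space N. Y 1 \<omega> \<in> A}"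
  shows "joint_law 2 N Y = joint_law 2 M (travellers_process 2 \<theta> X)"
proof -
  interpret prob_space M by fact
  obtain \<sigma> where \<sigma> [measurable]: "\<sigma> \<in> measurable M (count_space {p. p permutes {1..2}})"
    and law: "joint_law 2 N Y = joint_law 2 M (permuted X \<sigma>)"
    and Y: "\<And>i. i \<in> {1..2} \<Longrightarrow> Y i \<in> borel_measurable N"
    using assms(5) unfolding rearrangement_def by blast
  have X [measurable]: "random_variable borel (X 1)" "random_variable borel (X 2)"
    using assms(3) by (auto simp: indep_vars_def)
  have indep: "indep_var borel (X 1) borel (X 2)"
  proof -
    have "indep_var (Pi\<^sub>M {1} (\<lambda>_. borel)) (\<lambda>\<omega>. restrict (\<lambda>i. X i \<omega>) {1})
        (Pi\<^sub>M {2} (\<lambda>_. borel)) (\<lambda>\<omega>. restrict (\<lambda>i. X i \<omega>) {2})"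
      by (rule indep_var_restrict[OF assms(3)]) auto
    from indep_var_compose[OF this, of "\<lambda>v. v 1" borel "\<lambda>v. v 2" borel]
    show ?thesis by (simp add: comp_def)
  qed
  let ?Z = "permuted X \<sigma>" and ?T = "travellers_process 2 \<theta> X"
  have eq: "{1..2} = {1, 2 :: nat}" by auto
  have \<sigma>_cases: "\<sigma> \<omega> = id \<or> \<sigma> \<omega> = Transposition.transpose 1 2" if "\<omega> \<in> space M" for \<omega>
    using measurable_space[OF \<sigma> that] unfolding eq permutes_doubleton_iff by simp
  have Z [measurable]: "random_variable borel (?Z i)" if i: "i \<in> {1..2}" for i
  proof -
    \<comment> \<open>The random index takes only the values 1 and 2, so measurability of
      \<open>?Z i\<close> reduces to this one event.\<close>
    have [measurable]: "Measurable.pred M (\<lambda>\<omega>. \<sigma> \<omega> i = 1)"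
      by (rule measurable_compose[OF \<sigma>]) simp
    have "?Z i \<omega> = (if \<sigma> \<omega> i = 1 then X 1 \<omega> else X 2 \<omega>)" if "\<omega> \<in> space M" for \<omega>
      using \<sigma>_cases[OF that] i unfolding eq by (auto simp: permuted_def)
    then show ?thesis
      by (subst measurable_cong) (assumption, measurable)
  qed
  have T: "?T i = (\<lambda>\<omega>. if travel_map \<theta> (X 2 \<omega>) < travel_map \<theta> (X 1 \<omega>)
      then X (Transposition.transpose 1 2 i) \<omega> else X i \<omega>)" for i
    by (auto simp: travellers_process_def permuted_def travel_perm_2)
  have T_meas [measurable]: "random_variable borel (?T i)" if "i \<in> {1..2}" for i
    using that unfolding eq T by (auto simp del: One_nat_def cong: if_cong)
  have "prob {\<omega> \<in> space M. ?Z 2 \<omega> < ?Z 1 \<omega> \<and> ?Z 1 \<omega> \<in> A} = \<theta> * prob {\<omega> \<in> space M. ?Z 1 \<omega> \<in> A}"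
    if A [measurable]: "A \<in> sets borel" and "A \<subseteq> {0..1}" "emeasure lborel A > 0" for A
  proof -
    let ?B = "{z \<in> space (borel \<Otimes>\<^sub>M borel). snd z < fst z \<and> fst z \<in> A}" and ?C = "A \<times> UNIV"
    have B: "?B \<in> sets (borel \<Otimes>\<^sub>M borel)" and C: "?C \<in> sets (borel \<Otimes>\<^sub>M borel)"
      by measurable
    \<comment> \<open>The rank condition lives on \<open>N\<close>, the comparison with
      \<open>X\<close> on \<open>M\<close>. It concerns only the joint law of the pair, so equality
      of laws carries it over to \<open>?Z\<close>.\<close>
    have transfer: "prob {\<omega> \<in> space M. (?Z 1 \<omega>, ?Z 2 \<omega>) \<in> S} = measure N {\<omega> \<in> space N. (Y 1 \<omega>, Y 2 \<omega>) \<in> S}"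
      if "S \<in> sets (borel \<Otimes>\<^sub>M borel)" for S
      using measure_joint_law_2[of Y N S] measure_joint_law_2[of ?Z M S] Y Z that law by simp
    have "initial_rank Y 2 \<omega> = 2 \<longleftrightarrow> Y 2 \<omega> < Y 1 \<omega>" for \<omega>
    proof -
      have "{i \<in> {1..<2}. Y i \<omega> > Y 2 \<omega>} = (if Y 2 \<omega> < Y 1 \<omega> then {1} else {})"
        by (auto simp: order.strict_iff_order dest: le_antisym)
      then show ?thesis by (simp add: initial_rank_def)
    qed
    then show ?thesis
      using assms(7)[OF that] transfer[OF B] transfer[OF C] by (simp add: space_pair_measure)
  qed
  moreover have "?Z 1 \<omega> = X 1 \<omega> \<and> ?Z 2 \<omega> = X 2 \<omega> \<or> ?Z 1 \<omega> = X 2 \<omega> \<and> ?Z 2 \<omega> = X 1 \<omega>"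
    if "\<omega> \<in> space M" for \<omega>
    using \<sigma>_cases[OF that] by (auto simp: permuted_def)
  ultimately have "AE \<omega> in M. travel_map \<theta> (?Z 1 \<omega>) < travel_map \<theta> (?Z 2 \<omega>)"
    using assms(4) by (intro rearranged_pair_sorted[OF assms(6) indep _ _ Z Z]) auto
  \<comment> \<open>Both sequences order the same two values. Once \<open>?Z\<close> is strictly
    sorted by \<open>travel_map\<close>, the value of \<open>\<sigma>\<close> decides the comparison
    defining \<open>?T\<close>, so they agree pointwise and not merely in law.\<close>
  then have AE: "AE \<omega> in M. (\<lambda>i\<in>{1..2}. ?Z i \<omega>) = (\<lambda>i\<in>{1..2}. ?T i \<omega>)"
    using AE_space
  proof eventually_elim
    case (elim \<omega>)
    then show ?case
      using \<sigma>_cases[OF elim(2)] unfolding eq T by (auto simp: permuted_def fun_eq_iff restrict_def)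
  qed
  show ?thesis
    unfolding law unfolding joint_law_def
    by (intro distr_cong_AE AE measurable_restrict Z T_meas) auto
qed

end
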